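(* For every prime $q\ge 3$, every $r\ge 2$ and every $i\in\{0,\dots,\lfloor r/2\rfloor\}$ there is a permutation $\tau$ of $F_q^r$ such that the code $S_\tau$ is a propelinear $q$-ary code of length $\frac{q^{r+1}-1}{q-1}$ and rank $\frac{q^{r+1}-1}{q-1}-r-1+2i$.
   Context: Let $n=\frac{q^r-1}{q-1}$. Let $H_C$ be an $r\times n$ matrix over $F_q$ whose columns are representatives of the $n$ distinct one-dimensional subspaces of $F_q^r$, and for $a\in F_q^r$ let $C_a=\{x\in F_q^n: H_Cx^T=a\}$. Let $D$ be the linear code of length $q^r$ with positions indexed by vectors of $F_q^r$, $D=\{y=(y_c)_{c\in F_q^r}: \sum_c y_c=0,\ \sum_c y_c c={\bf 0}\}$, let $e_c$ be the unit vector at position $c$, and $D_a=D+e_{\bf 0}-e_a$. For a permutation $\tau$ of $F_q^r$, $S_\tau=\bigcup_{a\in F_q^r}C_a\times D_{\tau(a)}=\{(x|y):a\in F_q^r,\ x\in C_a,\ y\in D_{\tau(a)}\}$, where $|$ is concatenation. The rank of a code is the dimension of its $F_q$-linear span. A code $S\subseteq F_q^N$ is propelinear if the group of isometries of $F_q^N$ with respect to the Hamming metric that stabilize $S$ setwise contains a subgroup acting regularly on $S$. *)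

theory Defs
  imports "HOL-Analysis.Analysis" "HOL-Algebra.Bij"
begin

text \<open>
  A word of length \<open>N\<close> over the field \<open>'a\<close> is a vector of type \<open>'a ^ 'm\<close> with \<open>CARD('m) = N\<close>;
  the index type is the set of coordinate positions.
\<close>

definition hamming_dist :: "'a ^ 'm \<Rightarrow> 'a ^ 'm \<Rightarrow> nat" where
  "hamming_dist x y = card {k. x $ k \<noteq> y $ k}"

definition code_aut_group :: "('a ^ 'm) set \<Rightarrow> ('a ^ 'm \<Rightarrow> 'a ^ 'm) monoid" where
  "code_aut_group S = BijGroup UNIV
     \<lparr>carrier := {f \<in> Bij UNIV. (\<forall>x y. hamming_dist (f x) (f y) = hamming_dist x y) \<and> f ` S = S}\<rparr>"

definition acts_regularly :: "('b \<Rightarrow> 'b) set \<Rightarrow> 'b set \<Rightarrow> bool" where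
  "acts_regularly G S \<longleftrightarrow> (\<forall>x\<in>S. \<forall>y\<in>S. \<exists>!g. g \<in> G \<and> g x = y)"

definition propelinear :: "('a ^ 'm) set \<Rightarrow> bool" where
  "propelinear S \<longleftrightarrow> (\<exists>G. subgroup G (code_aut_group S) \<and> acts_regularly G S)"

definition code_rank :: "('a::field ^ 'm) set \<Rightarrow> nat" where
  "code_rank S = vec.dim (vec.span S)"

definition columns_represent_lines :: "'a::field ^ 'n ^ 'r \<Rightarrow> bool" where
  "columns_represent_lines H \<longleftrightarrow>
     bij_betw (\<lambda>j. vec.span {column j H}) UNIV {V. vec.subspace V \<and> vec.dim V = 1}"

definition C_coset :: "'a::field ^ 'n ^ 'r \<Rightarrow> 'a ^ 'r \<Rightarrow> ('a ^ 'n) set" where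
  "C_coset H a = {x. H *v x = a}"

definition D_code :: "('a::{field,finite} ^ ('a ^ 'r)) set" where
  "D_code = {y. (\<Sum>c\<in>UNIV. y $ c) = 0 \<and> (\<Sum>c\<in>UNIV. y $ c *s c) = 0}"

definition D_coset :: "'a::{field,finite} ^ 'r \<Rightarrow> ('a ^ ('a ^ 'r)) set" where
  "D_coset a = {d + axis 0 1 - axis a 1 | d. d \<in> D_code}"

definition vec_concat :: "'a ^ 'm \<Rightarrow> 'a ^ 'k \<Rightarrow> 'a ^ ('m + 'k)" where
  "vec_concat x y = (\<chi> p. case p of Inl j \<Rightarrow> x $ j | Inr c \<Rightarrow> y $ c)"

definition S_code ::
  "'a::{field,finite} ^ 'n ^ 'r \<Rightarrow> ('a ^ 'r \<Rightarrow> 'a ^ 'r) \<Rightarrow> ('a ^ ('n + 'a ^ 'r)) set" where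
  "S_code H \<tau> = (\<Union>a. {vec_concat x y | x y. x \<in> C_coset H a \<and> y \<in> D_coset (\<tau> a)})"

end

theory Submission imports Defs begin

text \<open>
  A word \<open>(x|y)\<close> lies in \<open>S\<^sub>\<tau>\<close> iff \<open>y\<close> has coordinate sum \<open>0\<close> and its syndrome \<open>\<Sum> y\<^sub>c c\<close> equals
  \<open>- \<tau> (H x)\<close>. Pair up \<open>2i\<close> coordinates of \<open>F\<^sub>q\<^sup>r\<close> as \<open>(a, b)\<close> and let \<open>\<alpha>\<close> add \<open>v\<^sub>a\<^sup>2\<close> to each \<open>v\<^sub>b\<close>, and
  \<open>\<beta>\<close> add \<open>v\<^sub>b\<^sup>2\<close> to each \<open>v\<^sub>a\<close>. For \<open>\<tau> = \<beta> \<circ> \<alpha>\<^sup>-\<^sup>1\<close> the syndromes of \<open>S\<^sub>\<tau>\<close> are the pairs \<open>(\<alpha> v, - \<beta> v)\<close>.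
  Both \<open>\<alpha>\<close> and \<open>\<beta>\<close> conjugate the translations of \<open>F\<^sub>q\<^sup>r\<close> into affine maps, and the linear part of an
  affine map of syndromes lifts uniquely to a monomial map of words; together with translations
  these lifts form a group acting regularly on \<open>S\<^sub>\<tau>\<close>. Since 2 is invertible, splitting
  \<open>v \<mapsto> (\<alpha> v, - \<beta> v)\<close> into odd and even parts shows that the syndromes span the space of all \<open>(s, t)\<close>
  with \<open>s\<^sub>k + t\<^sub>k = 0\<close> at the \<open>r - 2i\<close> unpaired coordinates \<open>k\<close>, which gives the rank.
\<close>

section \<open>Linear algebra\<close>

text \<open>A right inverse \<open>g\<close> of \<open>f\<close> on its range embeds
  \<open>range f\<close> as a complement of the kernel.\<close>

lemma rank_nullity_vec:
  fixes f :: "'a::field ^ 'm \<Rightarrow> 'a ^ 'k"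
  assumes "Vector_Spaces.linear (*s) (*s) f"
  shows "vec.dim (range f) + vec.dim {x. f x = 0} = CARD('m)"
proof -
  interpret f: Vector_Spaces.linear "(*s)" "(*s)" f by fact
  let ?K = "{x. f x = 0}"
  obtain g where g: "Vector_Spaces.linear (*s) (*s) g" and fg: "\<And>x. f (g (f x)) = f x"
    using vec.linear_exists_right_inverse_on[OF assms vec.subspace_UNIV] by auto
  interpret g: Vector_Spaces.linear "(*s)" "(*s)" g by fact
  have range: "vec.subspace (range f)"
    by (intro f.subspace_image vec.subspace_UNIV)
  have "inj_on g (range f)"
    by (rule inj_onI) (metis fg imageE)
  then have "vec.dim (g ` range f) = vec.dim (range f)"
    using vec.dim_image_eq[OF g] range by (metis vec.span_eq_iff)
  moreover have "g ` range f \<inter> ?K = {0}"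
    using fg f.zero g.zero by (auto simp: image_iff) (metis f.zero g.zero)+
  moreover have "{u + v |u v. u \<in> g ` range f \<and> v \<in> ?K} = UNIV"
  proof -
    have "x = g (f x) + (x - g (f x)) \<and> f (x - g (f x)) = 0" for x
      by (simp add: f.diff fg)
    then show ?thesis by blast
  qed
  ultimately show ?thesis
    using vec.dim_sums_Int[OF g.subspace_image[OF range] f.subspace_kernel]
    by (simp add: card_cart_basis)
qed

text \<open>Translation by 1 permutes the field, so \<open>CARD('a)\<close> times 1 is 0; with odd
  order and 2 = 0 this would say 1 = 0.\<close>

lemma two_neq_zero_if_odd_card:
  assumes "odd CARD('a::{field,finite})"
  shows "(2::'a) \<noteq> 0"
proof
  assume two: "(2::'a) = 0"
  have "(\<Sum>x\<in>(UNIV::'a set). x + 1) = (\<Sum>x\<in>UNIV. x)"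
    by (rule sum.reindex_bij_witness[where i = "\<lambda>x. x - 1" and j = "\<lambda>x. x + 1"]) auto
  then have "(of_nat CARD('a) :: 'a) = 0"
    by (simp add: sum.distrib)
  moreover obtain m where "CARD('a) = 2 * m + 1"
    using assms by (rule oddE)
  ultimately show False using two by simp
qed

section \<open>Propelinear codes\<close>

text \<open>
  The maps \<open>x \<mapsto> u + L u x\<close> for \<open>u \<in> S\<close> form a group, and each is determined by its value \<open>u\<close> at 0.
\<close>

lemma propelinearI:
  fixes S :: "('a::{field,finite} ^ 'm) set"
  assumes zero: "0 \<in> S"
    and add: "\<And>u x y. u \<in> S \<Longrightarrow> L u (x + y) = L u x + L u y"
    and isom: "\<And>u x y. u \<in> S \<Longrightarrow> hamming_dist (L u x) (L u y) = hamming_dist x y"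
    and closed: "\<And>u v. u \<in> S \<Longrightarrow> v \<in> S \<Longrightarrow> u + L u v \<in> S"
    and comp: "\<And>u v x. u \<in> S \<Longrightarrow> v \<in> S \<Longrightarrow> L (u + L u v) x = L u (L v x)"
  shows "propelinear S"
proof -
  define g where "g u x = u + L u x" for u x
  define G where "G = g ` S"
  have inj_g: "inj (g u)" if "u \<in> S" for u
  proof (rule injI)
    fix x y assume "g u x = g u y"
    then have "hamming_dist (L u x) (L u y) = 0"
      by (simp add: g_def hamming_dist_def)
    then have "hamming_dist x y = 0" using isom[OF that] by simp
    then show "x = y"
      by (simp add: hamming_dist_def vec_eq_iff)
  qed
  have bij_g: "bij (g u)" if "u \<in> S" for u
    using inj_g[OF that] by (simp add: bij_def finite_UNIV_inj_surj)
  have img: "g u ` S = S" if "u \<in> S" for u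
    by (rule endo_inj_surj) (use closed inj_g that in \<open>auto simp: g_def intro: inj_on_subset\<close>)
  have g_comp: "g (g u v) = g u \<circ> g v" if "u \<in> S" "v \<in> S" for u v
    using that by (auto simp: g_def fun_eq_iff add comp add.assoc)
  have L0: "L u 0 = 0" if "u \<in> S" for u
    using add[OF that, of 0 0] by simp
  then have g0: "g u 0 = u" if "u \<in> S" for u
    using that by (simp add: g_def)
  have g_zero: "g 0 = id"
  proof -
    \<comment> \<open>An injective idempotent map is the identity.\<close>
    have "g 0 \<circ> g 0 = g 0" using g_comp[OF zero zero] g0[OF zero] by simp
    then show ?thesis using inj_g[OF zero] by (auto simp: fun_eq_iff inj_def)
  qed
  have inv: "\<exists>v\<in>S. g u \<circ> g v = id \<and> g v \<circ> g u = id" if u: "u \<in> S" for u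
  proof -
    \<comment> \<open>The preimage \<open>v\<close> of 0 labels the inverse, since
      \<open>g u \<circ> g v\<close> is the map labelled by \<open>g u v\<close>.\<close>
    obtain v where v: "v \<in> S" "g u v = 0" using img[OF u] zero by (metis imageE)
    have 1: "g u \<circ> g v = id" using g_comp[OF u v(1)] v(2) g_zero by simp
    then have "g v \<circ> g u = id"
      by (metis bij_g[OF u] bij_is_surj bij_is_inj comp_assoc comp_id fun.inj_map_strong inv_o_cancel id_comp)
    with 1 v show ?thesis by blast
  qed
  have isom_g: "hamming_dist (g u x) (g u y) = hamming_dist x y" if "u \<in> S" for u x y
    using isom[OF that, of x y] by (simp add: g_def hamming_dist_def)
  let ?A = "code_aut_group S"
  have mem: "g u \<in> carrier ?A" if "u \<in> S" for u
    using that by (simp add: code_aut_group_def Bij_def bij_g isom_g img)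
  have Bij: "g u \<in> Bij UNIV" if "u \<in> S" for u
    using bij_g[OF that] by (simp add: Bij_def)
  have mult: "g u \<otimes>\<^bsub>?A\<^esub> g v = g u \<circ> g v" if "u \<in> S" "v \<in> S" for u v
    using that by (simp add: code_aut_group_def BijGroup_def Bij compose_def fun_eq_iff)
  have one: "\<one>\<^bsub>?A\<^esub> = id"
    by (auto simp: code_aut_group_def BijGroup_def)
  have "subgroup G ?A"
  proof (rule subgroup.intro)
    show "G \<subseteq> carrier ?A" using mem by (auto simp: G_def)
    show "\<one>\<^bsub>?A\<^esub> \<in> G" using one g_zero zero by (metis G_def imageI)
  next
    fix x y assume "x \<in> G" "y \<in> G"
    then obtain u v where uv: "u \<in> S" "v \<in> S" "x = g u" "y = g v" by (auto simp: G_def)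
    then show "x \<otimes>\<^bsub>?A\<^esub> y \<in> G"
      using mult g_comp closed by (metis G_def g_def imageI)
  next
    fix x assume "x \<in> G"
    then obtain u where u: "u \<in> S" "x = g u" by (auto simp: G_def)
    obtain v where v: "v \<in> S" "g u \<circ> g v = id" "g v \<circ> g u = id" using inv[OF u(1)] by blast
    have "m_inv ?A x = g v"
      unfolding m_inv_def
    proof (rule the_equality)
      show "g v \<in> carrier ?A \<and> x \<otimes>\<^bsub>?A\<^esub> g v = \<one>\<^bsub>?A\<^esub> \<and> g v \<otimes>\<^bsub>?A\<^esub> x = \<one>\<^bsub>?A\<^esub>"
        using u v mem mult one by simp
    next
      fix y assume y: "y \<in> carrier ?A \<and> x \<otimes>\<^bsub>?A\<^esub> y = \<one>\<^bsub>?A\<^esub> \<and> y \<otimes>\<^bsub>?A\<^esub> x = \<one>\<^bsub>?A\<^esub>"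
      then have "y \<in> Bij UNIV" by (simp add: code_aut_group_def)
      then have "g u \<circ> y = id"
        using y u Bij[OF u(1)] one
        by (auto simp: code_aut_group_def BijGroup_def compose_def fun_eq_iff)
      then show "y = g v" using v(3) by (metis comp_assoc comp_id id_comp)
    qed
    then show "m_inv ?A x \<in> G" using v by (auto simp: G_def)
  qed
  moreover have "acts_regularly G S"
    unfolding acts_regularly_def
  proof (intro ballI)
    fix x y assume x: "x \<in> S" and y: "y \<in> S"
    obtain v where v: "v \<in> S" "g x \<circ> g v = id" "g v \<circ> g x = id" using inv[OF x] by blast
    show "\<exists>!h. h \<in> G \<and> h x = y"
    \<comment> \<open>The inverse of \<open>g x\<close> sends \<open>x\<close> to 0, and
      \<open>g y\<close> sends 0 to \<open>y\<close>.\<close>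
    proof (rule ex1I[of _ "g y \<circ> g v"])
      have "g y \<circ> g v \<in> G"
        using g_comp[OF y v(1)] closed[OF y v(1)] by (metis G_def g_def imageI)
      moreover have "g v x = 0" using v(3) g0[OF x] g0[OF zero] g_zero
        by (metis comp_apply id_apply)
      ultimately show "g y \<circ> g v \<in> G \<and> (g y \<circ> g v) x = y" using g0[OF y] by simp
    next
      fix h assume h: "h \<in> G \<and> h x = y"
      then obtain u where u: "u \<in> S" "h = g u" by (auto simp: G_def)
      have "g u \<circ> g x = g y" using g_comp[OF u(1) x] h u by simp
      then show "h = g y \<circ> g v" using u v(2) by (metis comp_assoc comp_id)
    qed
  qed
  ultimately show ?thesis unfolding propelinear_def by blast
qed

section \<open>Quadratic shears\<close>

definition quad_shear :: "'r set \<Rightarrow> ('r \<Rightarrow> 'r) \<Rightarrow> 'a::comm_ring_1 ^ 'r \<Rightarrow> 'a ^ 'r" where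
  "quad_shear K \<pi> v = (\<chi> k. v $ k + (if k \<in> K then (v $ \<pi> k)\<^sup>2 else 0))"

text \<open>The derivative of \<open>quad_shear K \<pi>\<close> at \<open>w\<close>; its extra term
  is the polarization of the square.\<close>

definition lin_shear :: "'r set \<Rightarrow> ('r \<Rightarrow> 'r) \<Rightarrow> 'a::comm_ring_1 ^ 'r \<Rightarrow> 'a ^ 'r \<Rightarrow> 'a ^ 'r" where
  "lin_shear K \<pi> w z = (\<chi> k. z $ k + (if k \<in> K then 2 * w $ \<pi> k * z $ \<pi> k else 0))"

lemma quad_shear_zero [simp]: "quad_shear K \<pi> 0 = 0"
  by (simp add: quad_shear_def vec_eq_iff)

lemma linear_lin_shear: "Vector_Spaces.linear (*s) (*s) (lin_shear K \<pi> (w :: 'a::field ^ 'r))"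
  by unfold_locales (auto simp: lin_shear_def vec_eq_iff algebra_simps)

lemma lin_shear_zero: "lin_shear K \<pi> 0 z = z"
  by (simp add: lin_shear_def vec_eq_iff)

text \<open>Disjointness of \<open>K\<close> and \<open>\<pi> ` K\<close> makes the shear in direction \<open>K\<close> conjugate translations
  into affine maps.\<close>

lemma quad_shear_add:
  assumes "\<forall>k\<in>K. \<pi> k \<notin> K"
  shows "quad_shear K \<pi> (w + v) = quad_shear K \<pi> w + lin_shear K \<pi> w (quad_shear K \<pi> v)"
  using assms by (auto simp: quad_shear_def lin_shear_def vec_eq_iff power2_eq_square algebra_simps)

text \<open>The coordinates that are read lie outside \<open>K\<close> and stay fixed, so the added
  terms accumulate linearly in \<open>w\<close>.\<close>

lemma lin_shear_add:
  assumes "\<forall>k\<in>K. \<pi> k \<notin> K"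
  shows "lin_shear K \<pi> (w + v) z = lin_shear K \<pi> w (lin_shear K \<pi> v z)"
  using assms by (auto simp: lin_shear_def vec_eq_iff algebra_simps)

lemma lin_shear_uminus_cancel:
  assumes "\<forall>k\<in>K. \<pi> k \<notin> K"
  shows "lin_shear K \<pi> w (lin_shear K \<pi> (- w) z) = z" "lin_shear K \<pi> (- w) (lin_shear K \<pi> w z) = z"
  using lin_shear_add[OF assms, of w "- w" z] lin_shear_add[OF assms, of "- w" w z]
  by (simp_all add: lin_shear_zero)

lemma bij_quad_shear:
  assumes "\<forall>k\<in>K. \<pi> k \<notin> K"
  shows "bij (quad_shear K \<pi>)"
proof (rule o_bij)
  let ?h = "\<lambda>v. \<chi> k. v $ k - (if k \<in> K then (v $ \<pi> k)\<^sup>2 else 0)"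
  show "?h \<circ> quad_shear K \<pi> = id" "quad_shear K \<pi> \<circ> ?h = id"
    using assms by (auto simp: quad_shear_def fun_eq_iff vec_eq_iff)
qed

text \<open>A set of \<open>2 * i\<close> coordinates is halved, and \<open>\<pi>\<close> swaps the
  halves along a bijection.\<close>

lemma disjoint_pairing_exists:
  assumes "2 * i \<le> CARD('r::finite)"
  obtains A B :: "'r::finite set" and \<pi> :: "'r::finite \<Rightarrow> 'r"
  where "A \<inter> B = {}" "card (A \<union> B) = 2 * i" "\<And>k. \<pi> (\<pi> k) = k"
    "\<And>k. k \<in> A \<Longrightarrow> \<pi> k \<in> B" "\<And>k. k \<in> B \<Longrightarrow> \<pi> k \<in> A"
proof -
  obtain M :: "'r set" where M: "card M = 2 * i"
    using assms obtain_subset_with_card_n[of "2 * i" "UNIV :: 'r set"] by auto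
  obtain A where A: "A \<subseteq> M" "card A = i"
    using obtain_subset_with_card_n[of i M] M by auto
  define B where "B = M - A"
  have B: "card B = i" using A M by (simp add: B_def card_Diff_subset)
  obtain f where f: "bij_betw f A B"
    using finite_same_card_bij[of A B] A B by auto
  \<comment> \<open>The default value \<open>k\<close> keeps \<open>\<pi>\<close> an involution on
    all of \<open>'r\<close>.\<close>
  define \<pi> where "\<pi> k = (if k \<in> A then f k else if k \<in> B then inv_into A f k else k)" for k
  have disj: "A \<inter> B = {}" by (auto simp: B_def)
  show ?thesis
  proof (rule that[of A B \<pi>])
    show "A \<inter> B = {}" by fact
    show "card (A \<union> B) = 2 * i" using M A by (simp add: B_def Un_absorb1)
    have fA: "f k \<in> B" if "k \<in> A" for k using f that by (rule bij_betwE[THEN bspec])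
    have gB: "inv_into A f k \<in> A" if "k \<in> B" for k
      using f that by (metis bij_betw_imp_surj_on inv_into_into)
    show "\<pi> k \<in> B" if "k \<in> A" for k using fA that by (simp add: \<pi>_def)
    show "\<pi> k \<in> A" if "k \<in> B" for k using gB that disj by (auto simp: \<pi>_def)
    show "\<pi> (\<pi> k) = k" for k
    proof -
      have "inv_into A f (f k) = k" if "k \<in> A"
        using f that by (rule bij_betw_inv_into_left)
      moreover have "f (inv_into A f k) = k" if "k \<in> B"
        using f that by (rule bij_betw_inv_into_right)
      ultimately show ?thesis
        using fA gB disj by (auto simp: \<pi>_def)
    qed
  qed
qed

section \<open>Monomial lifts\<close>

text \<open>Intended for \<open>v \<noteq> 0\<close>, where the column spanning the line of
  \<open>v\<close> and its coefficient are unique; at 0 every index qualifies.\<close>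

definition line_index :: "'a::field ^ 'n ^ 'r \<Rightarrow> 'a ^ 'r \<Rightarrow> 'n" where
  "line_index H v = (SOME j. \<exists>c. v = c *s column j H)"

definition line_scale :: "'a::field ^ 'n ^ 'r \<Rightarrow> 'a ^ 'r \<Rightarrow> 'a" where
  "line_scale H v = (SOME c. v = c *s column (line_index H v) H)"

lemma column_neq_zero:
  assumes "columns_represent_lines H"
  shows "column j H \<noteq> 0"
proof -
  have "vec.span {column j H} \<in> {V. vec.subspace V \<and> vec.dim V = 1}"
    using bij_betwE[OF assms[unfolded columns_represent_lines_def]] by blast
  then show ?thesis by auto
qed

lemma line_decomposition:
  assumes "columns_represent_lines H" "v \<noteq> 0"
  shows "v = line_scale H v *s column (line_index H v) H"
proof -
  have "vec.span {v} \<in> {V. vec.subspace V \<and> vec.dim V = 1}"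
    using assms(2) by (simp add: vec.dim_span)
  then obtain j where "vec.span {v} = vec.span {column j H}"
    using bij_betw_imp_surj_on[OF assms(1)[unfolded columns_represent_lines_def]] by blast
  then have "v \<in> vec.span {column j H}"
    using vec.span_base[of v "{v}"] by auto
  then have "\<exists>j c. v = c *s column j H" by (auto simp: vec.span_singleton)
  then have "\<exists>c. v = c *s column (line_index H v) H"
    unfolding line_index_def by (rule someI_ex)
  then show ?thesis unfolding line_scale_def by (rule someI_ex)
qed

lemma line_decomposition_unique:
  assumes H: "columns_represent_lines H" and "c \<noteq> 0" and eq: "c *s column j H = d *s column k H"
  shows "j = k \<and> c = d"
proof -
  have "d \<noteq> 0" using eq \<open>c \<noteq> 0\<close> column_neq_zero[OF H, of j] by auto
  have "vec.span {column j H} = vec.span {c *s column j H}"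
    using vec.span_image_scale[of "{column j H}" "\<lambda>_. c"] \<open>c \<noteq> 0\<close> by simp
  also have "\<dots> = vec.span {column k H}"
    unfolding eq using vec.span_image_scale[of "{column k H}" "\<lambda>_. d"] \<open>d \<noteq> 0\<close> by simp
  finally have "j = k"
    using H by (auto simp: columns_represent_lines_def bij_betw_def inj_on_def)
  then show ?thesis using eq column_neq_zero[OF H, of k] by auto
qed

lemma line_scale_neq_zero:
  assumes "columns_represent_lines H" "v \<noteq> 0"
  shows "line_scale H v \<noteq> 0"
  using line_decomposition[OF assms] assms(2) by auto

text \<open>Scaling the decomposition of \<open>v\<close> gives one of \<open>c *s v\<close>, and
  decompositions are unique. This homogeneity lets lifts compose.\<close>

lemma line_scale_index_scaled:
  assumes H: "columns_represent_lines H" and "v \<noteq> 0" "c \<noteq> 0"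
  shows "line_index H (c *s v) = line_index H v" "line_scale H (c *s v) = c * line_scale H v"
proof -
  have "line_scale H (c *s v) *s column (line_index H (c *s v)) H
    = (c * line_scale H v) *s column (line_index H v) H"
    using line_decomposition[OF H, of "c *s v"] line_decomposition[OF H, of v] assms
    by (metis vec.scale_eq_0_iff vec.scale_scale)
  moreover have "line_scale H (c *s v) \<noteq> 0"
    using line_scale_neq_zero[OF H] assms by simp
  ultimately show "line_index H (c *s v) = line_index H v" "line_scale H (c *s v) = c * line_scale H v"
    using line_decomposition_unique[OF H] by blast+
qed

lemma line_scale_index_column:
  assumes H: "columns_represent_lines H"
  shows "line_index H (column j H) = j" "line_scale H (column j H) = 1"
  using line_decomposition_unique[OF H, of 1 j "line_scale H (column j H)" "line_index H (column j H)"]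
    line_decomposition[OF H column_neq_zero[OF H, of j]] by auto

lemma axis_nth_scale: "axis b t $ c *s v = (if c = b then t *s v else (0 :: 'a::field ^ 'm))"
  by (simp add: axis_def)

lemma sum_axis_nth: "(\<Sum>c\<in>UNIV. axis b t $ c) = t"
  by (simp add: axis_def)

lemma matrix_vector_mult_axis: "A *v axis j 1 = column j (A :: 'a::field ^ 'n ^ 'm)"
  by (simp add: matrix_mult_sum axis_nth_scale)

lemma surj_columns_represent_lines:
  assumes "columns_represent_lines H"
  shows "\<exists>x. H *v x = a"
proof (cases "a = 0")
  case False
  then have "H *v (line_scale H a *s axis (line_index H a) 1) = a"
    using line_decomposition[OF assms False] by (simp add: vec.scale matrix_vector_mult_axis)
  then show ?thesis by blast
qed (metis matrix_vector_mult_0_right)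

text \<open>
  The function \<open>v \<mapsto> x $ line_index H v / line_scale H v\<close> on nonzero vectors takes the value \<open>x $ j\<close> at
  column \<open>j\<close> and is homogeneous of degree \<open>-1\<close>.
  On the positions in \<open>'n\<close>, the lift composes this function with \<open>A\<close>. The lift is contravariant: it acts
  on syndromes by the inverses of \<open>A\<close> and \<open>B\<close>.
\<close>

definition monomial_lift ::
  "'a::{field,finite} ^ 'n ^ 'r \<Rightarrow> ('a ^ 'r \<Rightarrow> 'a ^ 'r) \<Rightarrow> ('a ^ 'r \<Rightarrow> 'a ^ 'r) \<Rightarrow>
   'a ^ ('n + 'a ^ 'r) \<Rightarrow> 'a ^ ('n + 'a ^ 'r)" where
  "monomial_lift H A B z = (\<chi> p. case p of
      Inl j \<Rightarrow> z $ Inl (line_index H (A (column j H))) / line_scale H (A (column j H))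
    | Inr c \<Rightarrow> z $ Inr (B c))"

lemma nth_monomial_lift [simp]:
  "monomial_lift H A B z $ Inl j = z $ Inl (line_index H (A (column j H))) / line_scale H (A (column j H))"
  "monomial_lift H A B z $ Inr c = z $ Inr (B c)"
  by (simp_all add: monomial_lift_def)

lemma monomial_lift_add:
  "monomial_lift H A B (x + y) = monomial_lift H A B x + monomial_lift H A B y"
  by (auto simp: vec_eq_iff split_sum_all add_divide_distrib)

lemma hamming_dist_monomial:
  assumes "bij p" "\<And>k. m k \<noteq> 0" "\<And>z k. f z $ k = z $ p k / (m k :: 'a::field)"
  shows "hamming_dist (f x) (f y) = hamming_dist x y"
proof -
  have "{k. f x $ k \<noteq> f y $ k} = p -` {k. x $ k \<noteq> y $ k}"
    using assms(2,3) by auto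
  then show ?thesis
    unfolding hamming_dist_def using assms(1) by (metis bij_def card_vimage_inj subset_UNIV)
qed

section \<open>Syndromes of concatenated words\<close>

definition x_syndrome :: "'a::field ^ 'n ^ 'r \<Rightarrow> 'a ^ ('n + 'k::finite) \<Rightarrow> 'a ^ 'r" where
  "x_syndrome H z = H *v (\<chi> j. z $ Inl j)"

text \<open>Together with \<open>y_sum\<close>, a parity check for \<open>D_code\<close> on the
  right half of a word.\<close>

definition y_syndrome :: "('a::{field,finite}) ^ ('n::finite + 'a ^ 'r) \<Rightarrow> 'a ^ 'r" where
  "y_syndrome z = (\<Sum>c\<in>UNIV. z $ Inr c *s c)"

definition y_sum :: "('a::field) ^ ('n::finite + 'k::finite) \<Rightarrow> 'a" where
  "y_sum z = (\<Sum>c\<in>UNIV. z $ Inr c)"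

lemma x_syndrome_eq_sum: "x_syndrome H z = (\<Sum>j\<in>UNIV. z $ Inl j *s column j H)"
  by (simp add: x_syndrome_def matrix_mult_sum)

lemma syndrome_add:
  "x_syndrome H (z + z') = x_syndrome H z + x_syndrome H z'"
  "y_syndrome (w + w') = y_syndrome w + y_syndrome w'"
  "y_sum (u + u') = y_sum u + y_sum u'"
  by (simp_all add: x_syndrome_eq_sum y_syndrome_def y_sum_def sum.distrib vec.scale_left_distrib)

lemma syndrome_scale:
  "x_syndrome H (c *s z) = c *s x_syndrome H z"
  "y_syndrome (d *s w) = d *s y_syndrome w"
  "y_sum (e *s u) = e * y_sum u"
  by (simp_all add: x_syndrome_eq_sum y_syndrome_def y_sum_def vec.scale_sum_right sum_distrib_left)

lemma syndrome_diff:
  "x_syndrome H (z - z') = x_syndrome H z - x_syndrome H z'"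
  "y_syndrome (w - w') = y_syndrome w - y_syndrome w'"
  "y_sum (u - u') = y_sum u - y_sum u'"
  by (simp_all add: x_syndrome_eq_sum y_syndrome_def y_sum_def sum_subtractf
      vec.scale_left_diff_distrib)

lemma syndrome_zero [simp]: "x_syndrome H 0 = 0" "y_syndrome 0 = 0" "y_sum 0 = 0"
  by (simp_all add: x_syndrome_eq_sum y_syndrome_def y_sum_def)

section \<open>Monomial lifts acting on distances and syndromes\<close>

context
  fixes H :: "'a::{field,finite} ^ 'n ^ 'r" and A A' B B' :: "'a ^ 'r \<Rightarrow> 'a ^ 'r"
  assumes H: "columns_represent_lines H"
    and lin: "Vector_Spaces.linear (*s) (*s) A" "Vector_Spaces.linear (*s) (*s) A'"
      "Vector_Spaces.linear (*s) (*s) B'"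
    and inv: "\<And>v. A (A' v) = v" "\<And>v. A' (A v) = v" "\<And>v. B (B' v) = v" "\<And>v. B' (B v) = v"
begin

interpretation A: Vector_Spaces.linear "(*s)" "(*s)" A by (rule lin)
interpretation A': Vector_Spaces.linear "(*s)" "(*s)" A' by (rule lin)
interpretation B': Vector_Spaces.linear "(*s)" "(*s)" B' by (rule lin)

lemma lift_map_neq_zero: "v \<noteq> 0 \<Longrightarrow> A v \<noteq> 0"
  by (metis inv(2) A'.zero)

lemma lift_inverse_neq_zero: "v \<noteq> 0 \<Longrightarrow> A' v \<noteq> 0"
  by (metis inv(1) A.zero)

lemma column_line_index:
  "column j H = line_scale H (A (column j H)) *s A' (column (line_index H (A (column j H))) H)"
  by (metis A'.scale lift_map_neq_zero H column_neq_zero inv(2) line_decomposition)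

text \<open>\<open>A'\<close> maps the line of the new column back to that of
  \<open>column j H\<close>, so the index map of \<open>A'\<close> is a left inverse of the index
  map of \<open>A\<close>.\<close>

lemma line_index_inverse: "line_index H (A' (column (line_index H (A (column j H))) H)) = j"
  using column_line_index[of j] line_scale_neq_zero[OF H lift_map_neq_zero[OF column_neq_zero[OF H]], of j]
    line_scale_index_scaled(1)[OF H lift_inverse_neq_zero[OF column_neq_zero[OF H]]]
    line_scale_index_column(1)[OF H] by metis

lemma bij_line_index: "bij (\<lambda>j. line_index H (A (column j H)))"
proof -
  have "inj (\<lambda>j. line_index H (A (column j H)))"
    by (rule injI) (metis line_index_inverse)
  then show ?thesis by (simp add: bij_def finite_UNIV_inj_surj)
qed

lemma bij_lift_positions: "bij B"
  by (rule o_bij[of B']) (auto simp: inv)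

lemma hamming_dist_monomial_lift:
  "hamming_dist (monomial_lift H A B x) (monomial_lift H A B y) = hamming_dist x y"
proof (rule hamming_dist_monomial)
  let ?\<sigma> = "\<lambda>j. line_index H (A (column j H))"
  show "bij (map_sum ?\<sigma> B)"
  proof -
    have "inj (map_sum ?\<sigma> B)"
      using bij_line_index bij_lift_positions by (intro sum.inj_map bij_is_inj)
    then show ?thesis by (simp add: bij_def finite_UNIV_inj_surj)
  qed
  show "(case k of Inl j \<Rightarrow> line_scale H (A (column j H)) | Inr c \<Rightarrow> 1) \<noteq> 0" for k
    using line_scale_neq_zero[OF H lift_map_neq_zero[OF column_neq_zero[OF H]]] by (simp split: sum.split)
  show "monomial_lift H A B z $ k =
      z $ map_sum ?\<sigma> B k / (case k of Inl j \<Rightarrow> line_scale H (A (column j H)) | Inr c \<Rightarrow> 1)" for z k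
    by (cases k) simp_all
qed

lemma y_sum_monomial_lift: "y_sum (monomial_lift H A B z) = y_sum z"
  unfolding y_sum_def using bij_lift_positions by (simp add: sum.reindex_bij_betw[of B UNIV UNIV "\<lambda>c. z $ Inr c"])

lemma y_syndrome_monomial_lift: "y_syndrome (monomial_lift H A B z) = B' (y_syndrome z)"
proof -
  have "y_syndrome (monomial_lift H A B z) = (\<Sum>c\<in>UNIV. z $ Inr (B c) *s B' (B c))"
    by (simp add: y_syndrome_def inv)
  also have "\<dots> = (\<Sum>c\<in>UNIV. z $ Inr c *s B' c)"
    using bij_lift_positions by (rule sum.reindex_bij_betw)
  finally show ?thesis by (simp add: y_syndrome_def B'.sum B'.scale)
qed

text \<open>The division in the lift cancels the scale in \<open>column_line_index\<close>, leaving
  the images under \<open>A'\<close> of the summands of \<open>x_syndrome H z\<close>,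
  permuted.\<close>

lemma x_syndrome_monomial_lift: "x_syndrome H (monomial_lift H A B z) = A' (x_syndrome H z)"
proof -
  let ?\<sigma> = "\<lambda>j. line_index H (A (column j H))"
  have "monomial_lift H A B z $ Inl j *s column j H = z $ Inl (?\<sigma> j) *s A' (column (?\<sigma> j) H)" for j
  proof -
    let ?s = "line_scale H (A (column j H))"
    have "monomial_lift H A B z $ Inl j *s column j H
      = (z $ Inl (?\<sigma> j) / ?s) *s (?s *s A' (column (?\<sigma> j) H))"
      using column_line_index[of j] by (metis nth_monomial_lift(1))
    then show ?thesis
      using line_scale_neq_zero[OF H lift_map_neq_zero[OF column_neq_zero[OF H]], of j] by simp
  qed
  then have "x_syndrome H (monomial_lift H A B z) = (\<Sum>j\<in>UNIV. z $ Inl (?\<sigma> j) *s A' (column (?\<sigma> j) H))"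
    by (simp add: x_syndrome_eq_sum)
  also have "\<dots> = (\<Sum>j\<in>UNIV. z $ Inl j *s A' (column j H))"
    using bij_line_index by (rule sum.reindex_bij_betw)
  finally show ?thesis by (simp add: x_syndrome_eq_sum A'.sum A'.scale)
qed

text \<open>With \<open>k\<close> the line index of \<open>A (column j H)\<close>, homogeneity gives
  \<open>A2 (A (column j H))\<close> the index of \<open>A2 (column k H)\<close> and the product of
  the two scales.\<close>

lemma monomial_lift_comp:
  assumes "Vector_Spaces.linear (*s) (*s) A2" "\<And>v. v \<noteq> 0 \<Longrightarrow> A2 v \<noteq> 0"
  shows "monomial_lift H A B (monomial_lift H A2 B2 z) = monomial_lift H (A2 \<circ> A) (B2 \<circ> B) z"
proof -
  interpret A2: Vector_Spaces.linear "(*s)" "(*s)" A2 by fact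
  have "monomial_lift H A B (monomial_lift H A2 B2 z) $ Inl j = monomial_lift H (A2 \<circ> A) (B2 \<circ> B) z $ Inl j" for j
  proof -
    let ?v = "A (column j H)"
    let ?k = "line_index H ?v"
    have v: "?v \<noteq> 0" using lift_map_neq_zero column_neq_zero[OF H] by blast
    have "A2 ?v = line_scale H ?v *s A2 (column ?k H)"
      by (metis A2.scale line_decomposition[OF H v])
    moreover have "A2 (column ?k H) \<noteq> 0" using assms(2) column_neq_zero[OF H] by blast
    ultimately show ?thesis
      using line_scale_index_scaled[OF H, of "A2 (column ?k H)" "line_scale H ?v"] line_scale_neq_zero[OF H v]
      by (simp add: mult.commute)
  qed
  then show ?thesis by (simp add: vec_eq_iff split_sum_all)
qed

end

section \<open>The codes\<close>

text \<open>The shift \<open>axis 0 1 - axis a 1\<close> has coordinate sum 0 and weighted sum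
  \<open>- a\<close>.\<close>

lemma mem_D_coset_iff:
  "y \<in> D_coset a \<longleftrightarrow> (\<Sum>c\<in>UNIV. y $ c) = 0 \<and> (\<Sum>c\<in>UNIV. y $ c *s c) = - a"
proof -
  have ax: "(\<Sum>c\<in>UNIV. axis b 1 $ c *s c) = b" "(\<Sum>c\<in>UNIV. axis b 1 $ c) = (1::'a)" for b :: "'a ^ 'r"
    by (simp_all add: axis_nth_scale sum_axis_nth)
  have "y \<in> D_coset a \<longleftrightarrow> y - axis 0 1 + axis a 1 \<in> D_code"
    unfolding D_coset_def by (auto simp: algebra_simps) (metis add_diff_cancel_left' diff_add_cancel add.commute)
  also have "\<dots> \<longleftrightarrow> (\<Sum>c\<in>UNIV. y $ c) = 0 \<and> (\<Sum>c\<in>UNIV. y $ c *s c) + a = 0"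
    by (simp add: D_code_def sum.distrib sum_subtractf vec.scale_left_distrib vec.scale_left_diff_distrib ax)
  finally show ?thesis by (simp add: eq_neg_iff_add_eq_0)
qed

lemma mem_S_code_iff:
  "z \<in> S_code H \<tau> \<longleftrightarrow> y_sum z = 0 \<and> y_syndrome z = - \<tau> (x_syndrome H z)"
proof -
  have *: "z = vec_concat x y \<longleftrightarrow> x = (\<chi> j. z $ Inl j) \<and> y = (\<chi> c. z $ Inr c)" for x y
    by (auto simp: vec_concat_def vec_eq_iff split_sum_all split: sum.split)
  show ?thesis
    unfolding S_code_def C_coset_def x_syndrome_def y_syndrome_def y_sum_def
    by (auto simp: * mem_D_coset_iff)
qed

lemma syndromes_surj:
  fixes H :: "'a::{field,finite} ^ 'n ^ 'r" and b :: "'a ^ 'r"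
  assumes "columns_represent_lines H"
  shows "\<exists>z. x_syndrome H z = a \<and> y_sum z = s \<and> y_syndrome z = b"
proof -
  obtain x where x: "H *v x = a" using surj_columns_represent_lines[OF assms] by blast
  \<comment> \<open>Position 0 contributes nothing to the weighted sum, so its entry is free to
    adjust the coordinate sum to \<open>s\<close>.\<close>
  define y :: "'a ^ ('a ^ 'r)" where "y = axis b 1 + axis 0 (s - 1)"
  have "(\<Sum>c\<in>UNIV. y $ c) = s"
    by (simp add: y_def sum.distrib sum_axis_nth)
  moreover have "(\<Sum>c\<in>UNIV. y $ c *s c) = b"
    by (simp add: y_def vec.scale_left_distrib sum.distrib axis_nth_scale)
  ultimately show ?thesis
    using x by (intro exI[of _ "vec_concat x y"])
      (simp add: x_syndrome_def y_sum_def y_syndrome_def vec_concat_def)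
qed

lemma propelinear_S_code_quad_shear:
  fixes H :: "'a::{field,finite} ^ 'n ^ 'r"
  assumes H: "columns_represent_lines H"
    and K: "\<forall>k\<in>K. \<pi> k \<notin> K" and M: "\<forall>k\<in>M. \<rho> k \<notin> M"
  shows "propelinear (S_code H (quad_shear M \<rho> \<circ> inv_into UNIV (quad_shear K \<pi>)))"
proof -
  let ?\<alpha> = "quad_shear K \<pi> :: 'a ^ 'r \<Rightarrow> 'a ^ 'r" and ?\<beta> = "quad_shear M \<rho> :: 'a ^ 'r \<Rightarrow> 'a ^ 'r"
  let ?A = "lin_shear K \<pi> :: 'a ^ 'r \<Rightarrow> 'a ^ 'r \<Rightarrow> 'a ^ 'r"
  let ?B = "lin_shear M \<rho> :: 'a ^ 'r \<Rightarrow> 'a ^ 'r \<Rightarrow> 'a ^ 'r"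
  let ?S = "S_code H (?\<beta> \<circ> inv_into UNIV ?\<alpha>)"
  \<comment> \<open>For a codeword \<open>z\<close>, this recovers the parameter \<open>v\<close> of
    its syndromes \<open>(\<alpha> v, - \<beta> v)\<close>.\<close>
  define w where "w z = inv_into UNIV ?\<alpha> (x_syndrome H z)" for z :: "'a ^ ('n + 'a ^ 'r)"
  \<comment> \<open>Lifts act on syndromes by inverses, so shears at \<open>- w u\<close> induce
    those at \<open>w u\<close>.\<close>
  define L where "L u = monomial_lift H (?A (- w u)) (?B (- w u))" for u
  have bij: "bij ?\<alpha>" by (rule bij_quad_shear[OF K])
  have S_iff: "z \<in> ?S \<longleftrightarrow> y_sum z = 0 \<and> y_syndrome z = - ?\<beta> (w z)" for z
    by (simp add: mem_S_code_iff w_def)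
  have x_syn: "x_syndrome H z = ?\<alpha> (w z)" for z
    unfolding w_def surj_f_inv_f[OF bij_is_surj[OF bij]] ..
  have w_eqI: "w z = v" if "x_syndrome H z = ?\<alpha> v" for z v
    using bij that by (simp add: w_def inv_f_f bij_is_inj)
  note lifts = H linear_lin_shear linear_lin_shear linear_lin_shear
    lin_shear_uminus_cancel(2)[OF K] lin_shear_uminus_cancel(1)[OF K]
    lin_shear_uminus_cancel(2)[OF M] lin_shear_uminus_cancel(1)[OF M]
  interpret B: Vector_Spaces.linear "(*s)" "(*s)" "?B v" for v by (rule linear_lin_shear)
  have w_L: "w (u + L u v) = w u + w v" for u v
  proof (rule w_eqI)
    have "x_syndrome H (u + L u v) = ?\<alpha> (w u) + ?A (w u) (?\<alpha> (w v))"
      unfolding L_def syndrome_add x_syndrome_monomial_lift[OF lifts] by (simp add: x_syn)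
    then show "x_syndrome H (u + L u v) = ?\<alpha> (w u + w v)" by (simp add: quad_shear_add[OF K])
  qed
  show ?thesis
  proof (rule propelinearI[where L = L])
    have "w 0 = 0" by (rule w_eqI) simp
    then show "0 \<in> ?S" by (simp add: S_iff)
    show "L u (x + y) = L u x + L u y" for u x y by (simp add: L_def monomial_lift_add)
    show "hamming_dist (L u x) (L u y) = hamming_dist x y" for u x y
      unfolding L_def by (rule hamming_dist_monomial_lift[OF lifts])
    show "u + L u v \<in> ?S" if "u \<in> ?S" "v \<in> ?S" for u v
    proof -
      have "y_sum (u + L u v) = 0"
        using that unfolding L_def syndrome_add y_sum_monomial_lift[OF lifts] by (simp add: S_iff)
      moreover have "y_syndrome (u + L u v) = y_syndrome u + ?B (w u) (y_syndrome v)"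
        unfolding L_def syndrome_add y_syndrome_monomial_lift[OF lifts] ..
      ultimately show ?thesis
        using that by (simp add: S_iff w_L quad_shear_add[OF M] B.neg)
    qed
    show "L (u + L u v) x = L u (L v x)" for u v x
    proof -
      have "?A (- w v) y \<noteq> 0" if "y \<noteq> 0" for y
        using lift_map_neq_zero[OF lifts] that by blast
      \<comment> \<open>Contravariance reverses the composition, which is harmless because the
        parameters add commutatively.\<close>
      then have "L u (L v x) = monomial_lift H (?A (- w v) \<circ> ?A (- w u)) (?B (- w v) \<circ> ?B (- w u)) x"
        unfolding L_def by (intro monomial_lift_comp[OF lifts] linear_lin_shear)
      also have "?A (- w v) \<circ> ?A (- w u) = ?A (- w v + - w u)"
        by (rule ext) (simp only: o_apply lin_shear_add[OF K])
      also have "?B (- w v) \<circ> ?B (- w u) = ?B (- w v + - w u)"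
        by (rule ext) (simp only: o_apply lin_shear_add[OF M])
      finally show ?thesis by (simp add: L_def w_L[unfolded L_def] add.commute)
    qed
  qed
qed

text \<open>Both shears fix the coordinates outside \<open>A \<union> B\<close>, which gives one
  inclusion. Conversely, the span realizes every admissible pair of syndromes, and words of sum 0
  with equal syndromes differ by a codeword.\<close>

lemma span_S_code_quad_shear:
  fixes H :: "'a::{field,finite} ^ 'n ^ 'r" and A B :: "'r set"
  assumes H: "columns_represent_lines H" and two: "(2::'a) \<noteq> 0"
    and disj: "A \<inter> B = {}" and \<pi>: "\<And>k. \<pi> (\<pi> k) = k"
    and AB: "\<And>k. k \<in> A \<Longrightarrow> \<pi> k \<in> B" and BA: "\<And>k. k \<in> B \<Longrightarrow> \<pi> k \<in> A"
  shows "vec.span (S_code H (quad_shear A \<pi> \<circ> inv_into UNIV (quad_shear B \<pi>))) =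
    {z. y_sum z = 0 \<and> (\<forall>k. k \<notin> A \<union> B \<longrightarrow> x_syndrome H z $ k + y_syndrome z $ k = 0)}"
    (is "vec.span ?S = ?W")
proof
  let ?\<alpha> = "quad_shear B \<pi> :: 'a ^ 'r \<Rightarrow> 'a ^ 'r" and ?\<beta> = "quad_shear A \<pi> :: 'a ^ 'r \<Rightarrow> 'a ^ 'r"
  have bij: "bij ?\<alpha>" by (rule bij_quad_shear) (use BA disj in blast)
  show "vec.span ?S \<subseteq> ?W"
  proof (rule vec.span_minimal)
    show "?S \<subseteq> ?W"
    proof
      fix z assume z: "z \<in> ?S"
      obtain v where v: "x_syndrome H z = ?\<alpha> v" using bij by (metis bij_pointE)
      then have "y_syndrome z = - ?\<beta> v" "y_sum z = 0"
        using z bij by (simp_all add: mem_S_code_iff inv_f_f bij_is_inj)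
      with v show "z \<in> ?W" by (simp add: quad_shear_def)
    qed
    show "vec.subspace ?W"
    proof (rule vec.subspaceI)
      fix u v assume uv: "u \<in> ?W" "v \<in> ?W"
      have "x_syndrome H (u + v) $ k + y_syndrome (u + v) $ k
        = (x_syndrome H u $ k + y_syndrome u $ k) + (x_syndrome H v $ k + y_syndrome v $ k)" for k
        by (simp add: syndrome_add)
      then show "u + v \<in> ?W" using uv by (simp add: syndrome_add(3))
    next
      fix c u assume u: "u \<in> ?W"
      have "x_syndrome H (c *s u) $ k + y_syndrome (c *s u) $ k
        = c * (x_syndrome H u $ k + y_syndrome u $ k)" for k
        by (simp add: syndrome_scale distrib_left)
      then show "c *s u \<in> ?W" using u by (simp add: syndrome_scale(3))
    qed simp
  qed
  show "?W \<subseteq> vec.span ?S"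
  proof
    define P where "P a b \<longleftrightarrow> (\<exists>z\<in>vec.span ?S. x_syndrome H z = a \<and> y_sum z = 0 \<and> y_syndrome z = b)" for a b
    have P_add: "P (a + a') (b + b')" if P: "P a b" "P a' b'" for a a' b b'
    proof -
      obtain z z' where "z \<in> vec.span ?S" "x_syndrome H z = a" "y_sum z = 0" "y_syndrome z = b"
        "z' \<in> vec.span ?S" "x_syndrome H z' = a'" "y_sum z' = 0" "y_syndrome z' = b'"
        using P unfolding P_def by blast
      then show ?thesis
        unfolding P_def by (intro bexI[of _ "z + z'"]) (simp_all add: syndrome_add vec.span_add)
    qed
    have P_scale: "P (c *s a) (c *s b)" if P: "P a b" for c a b
    proof -
      obtain z where "z \<in> vec.span ?S" "x_syndrome H z = a" "y_sum z = 0" "y_syndrome z = b"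
        using P unfolding P_def by blast
      then show ?thesis
        unfolding P_def by (intro bexI[of _ "c *s z"]) (simp_all add: syndrome_scale vec.span_scale)
    qed
    have P_graph: "P (?\<alpha> v) (- ?\<beta> v)" for v
    proof -
      obtain z where "x_syndrome H z = ?\<alpha> v" "y_sum z = 0" "y_syndrome z = - ?\<beta> v"
        using syndromes_surj[OF H] by metis
      moreover from this have "z \<in> ?S" using bij by (simp add: mem_S_code_iff inv_f_f bij_is_inj)
      ultimately show ?thesis unfolding P_def by (blast intro: vec.span_base)
    qed
    text \<open>Odd and even parts of the parametrization \<open>v \<mapsto> (\<alpha> v, - \<beta> v)\<close> of the syndromes.\<close>
    have P_diag: "P v (- v)" for v
    proof -
      have "P (?\<alpha> v + (-1) *s ?\<alpha> (- v)) (- ?\<beta> v + (-1) *s (- ?\<beta> (- v)))"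
        by (intro P_scale P_add P_graph)
      moreover have "?\<alpha> v + (-1) *s ?\<alpha> (- v) = 2 *s v"
        by (simp add: vec_eq_iff quad_shear_def)
      moreover have "- ?\<beta> v + (-1) *s (- ?\<beta> (- v)) = 2 *s (- v)"
        by (simp add: vec_eq_iff quad_shear_def)
      ultimately have "P (2 *s v) (2 *s (- v))" by simp
      from P_scale[OF this, of "inverse 2"] show ?thesis using two by simp
    qed
    \<comment> \<open>The even parts of \<open>?\<alpha>\<close> and \<open>?\<beta>\<close>, left
      once the diagonal pairs are subtracted.\<close>
    define sq :: "'r set \<Rightarrow> 'a ^ 'r \<Rightarrow> 'a ^ 'r" where "sq K v = (\<chi> k. if k \<in> K then (v $ \<pi> k)\<^sup>2 else 0)" for K v
    have P_sq: "P (sq B v) (- sq A v)" for v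
    proof -
      have "P (?\<alpha> v + - v) (- ?\<beta> v + - (- v))"
        by (intro P_add P_graph P_diag)
      moreover have "?\<alpha> v + - v = sq B v" "- ?\<beta> v + - (- v) = - sq A v"
        by (simp_all add: vec_eq_iff quad_shear_def sq_def)
      ultimately show ?thesis by simp
    qed
    \<comment> \<open>As 2 is invertible, every field element is a difference of two
      squares.\<close>
    have diff_sq: "((x + 1) * inverse 2)\<^sup>2 - ((x - 1) * inverse 2)\<^sup>2 = x" for x :: 'a
    proof -
      have "((x + 1) * h)\<^sup>2 - ((x - 1) * h)\<^sup>2 = (h * 2) * (h * 2) * x" for h
        by (simp add: power2_eq_square algebra_simps)
      from this[of "inverse 2"] show ?thesis using two by simp
    qed
    have P_B: "P u 0" if u: "\<And>k. k \<notin> B \<Longrightarrow> u $ k = 0" for u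
    proof -
      \<comment> \<open>Being supported on \<open>A\<close>, \<open>v t\<close> is killed by
        \<open>sq A\<close>, which reads coordinates in \<open>B\<close>; \<open>sq B\<close> sees
        the squares of \<open>diff_sq\<close>.\<close>
      define v where "v t = (\<chi> k. if k \<in> A then (u $ \<pi> k + t) * inverse 2 else 0)" for t
      have "P (sq B (v 1) + (-1) *s sq B (v (-1))) (- sq A (v 1) + (-1) *s (- sq A (v (-1))))"
        by (intro P_scale P_add P_sq)
      moreover have "sq A (v t) = 0" for t
        using AB disj by (auto simp: vec_eq_iff sq_def v_def)
      moreover have "sq B (v 1) + (-1) *s sq B (v (-1)) = u"
        using BA u diff_sq by (auto simp: vec_eq_iff sq_def v_def \<pi>)
      ultimately show ?thesis by simp
    qed
    have P_A: "P 0 (- u)" if u: "\<And>k. k \<notin> A \<Longrightarrow> u $ k = 0" for u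
    proof -
      define v where "v t = (\<chi> k. if k \<in> B then (u $ \<pi> k + t) * inverse 2 else 0)" for t
      have "P (sq B (v 1) + (-1) *s sq B (v (-1))) (- sq A (v 1) + (-1) *s (- sq A (v (-1))))"
        by (intro P_scale P_add P_sq)
      moreover have "sq B (v t) = 0" for t
        using BA disj by (auto simp: vec_eq_iff sq_def v_def)
      moreover have "- sq A (v 1) + (-1) *s (- sq A (v (-1))) = - (sq A (v 1) - sq A (v (-1)))"
        by (simp add: vec_eq_iff)
      moreover have "sq A (v 1) - sq A (v (-1)) = u"
        using AB u diff_sq by (auto simp: vec_eq_iff sq_def v_def \<pi>)
      ultimately show ?thesis by simp
    qed
    fix z assume z: "z \<in> ?W"
    let ?x = "x_syndrome H z" and ?y = "y_syndrome z"
    define r where "r K = (\<chi> k. if k \<in> K then ?x $ k + ?y $ k else 0)" for K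
    \<comment> \<open>With \<open>d = ?x - r B\<close>, the target is
      \<open>(r B, 0) + (d, - d) + (0, d + ?y)\<close>. The entry \<open>d + ?y\<close> is supported
      on \<open>A\<close>: on \<open>B\<close> it is cancelled by \<open>r B\<close>, and off
      \<open>A \<union> B\<close> it vanishes since \<open>z\<close> is in
      \<open>?W\<close>.\<close>
    have "P (r B + (?x - r B)) (0 + (- (?x - r B) + - (- (?x - r B) - ?y)))"
    proof -
      have "(- (?x - r B) - ?y) $ k = 0" if "k \<notin> A" for k
        using z that by (cases "k \<in> B") (auto simp: r_def algebra_simps)
      then have "P (?x - r B + 0) (- (?x - r B) + - (- (?x - r B) - ?y))"
        by (intro P_add P_diag P_A)
      moreover have "P (r B) 0" by (rule P_B) (simp add: r_def)
      ultimately show ?thesis using P_add[of "r B" 0 "?x - r B + 0"] by simp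
    qed
    then have "P ?x ?y" by simp
    then obtain z' where z': "z' \<in> vec.span ?S" "x_syndrome H z' = ?x" "y_sum z' = 0" "y_syndrome z' = ?y"
      unfolding P_def by blast
    \<comment> \<open>The difference has sum and syndromes 0, and the permutation defining the code
      fixes 0.\<close>
    have "z - z' \<in> ?S"
      using z z' inv_f_f[OF bij_is_inj[OF bij], of 0] by (simp add: mem_S_code_iff syndrome_diff)
    then have "z - z' + z' \<in> vec.span ?S"
      by (rule vec.span_add[OF vec.span_base z'(1)])
    then show "z \<in> vec.span ?S" by simp
  qed
qed

text \<open>Rank-nullity for the map \<open>T\<close> that lists the constraints, whose independence
  follows from \<open>syndromes_surj\<close>.\<close>

lemma dim_syndrome_subspace:
  fixes H :: "'a::{field,finite} ^ 'n ^ 'r" and M :: "'r set"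
  assumes H: "columns_represent_lines H"
  shows "vec.dim {z. y_sum z = 0 \<and> (\<forall>k. k \<notin> M \<longrightarrow> x_syndrome H z $ k + y_syndrome z $ k = 0)}
    + (CARD('r) - card M + 1) = CARD('n + 'a ^ 'r)"
proof -
  \<comment> \<open>\<open>None\<close> carries the coordinate sum; entries in \<open>M\<close> are
    set to 0 so that the range is a coordinate subspace.\<close>
  define T :: "'a ^ ('n + 'a ^ 'r) \<Rightarrow> 'a ^ ('r option)" where
    "T z = (\<chi> p. case p of None \<Rightarrow> y_sum z
      | Some k \<Rightarrow> if k \<in> M then 0 else x_syndrome H z $ k + y_syndrome z $ k)" for z
  have lin: "Vector_Spaces.linear (*s) (*s) T"
    by unfold_locales
      (auto simp: T_def vec_eq_iff syndrome_add syndrome_scale algebra_simps split: option.split)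
  let ?d = "insert None (Some ` (- M))"
  have "range T = {w. \<forall>p. p \<notin> ?d \<longrightarrow> w $ p = 0}"
  proof (rule subset_antisym; rule subsetI)
    fix w :: "'a ^ ('r option)" assume w: "w \<in> {w. \<forall>p. p \<notin> ?d \<longrightarrow> w $ p = 0}"
    obtain z where z: "x_syndrome H z = 0" "y_sum z = w $ None" "y_syndrome z = (\<chi> k. w $ Some k)"
      using syndromes_surj[OF H] by blast
    have "w = T z"
      using w by (auto simp: T_def vec_eq_iff z split: option.split)
    then show "w \<in> range T" by blast
  qed (auto simp: T_def split: option.split)
  then have "vec.dim (range T) = card ?d"
    by (simp only: dim_substandard_cart)
  also have "\<dots> = CARD('r) - card M + 1"
    by (simp add: card_image Compl_eq_Diff_UNIV card_Diff_subset)
  finally have "vec.dim {z. T z = 0} + (CARD('r) - card M + 1) = CARD('n + 'a ^ 'r)"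
    using rank_nullity_vec[OF lin] by simp
  moreover have "T z = 0 \<longleftrightarrow> y_sum z = 0 \<and> (\<forall>k. k \<notin> M \<longrightarrow> x_syndrome H z $ k + y_syndrome z $ k = 0)" for z
    by (auto simp: T_def vec_eq_iff split: option.split)
  ultimately show ?thesis by simp
qed

theorem theorem5:
  fixes H :: "'a::{field,finite} ^ 'n ^ 'r" and q r i :: nat
  assumes "CARD('a) = q" and "prime q" and "q \<ge> 3"
    and "CARD('r) = r" and "r \<ge> 2"
    and "i \<in> {0..r div 2}"
    and "real CARD('n) = (real q ^ r - 1) / (real q - 1)"
    and "columns_represent_lines H"
  shows "\<exists>\<tau>. bij \<tau> \<and> propelinear (S_code H \<tau>) \<and>
           real CARD('n + 'a ^ 'r) = (real q ^ (r + 1) - 1) / (real q - 1) \<and>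
           real (code_rank (S_code H \<tau>)) =
             (real q ^ (r + 1) - 1) / (real q - 1) - real r - 1 + 2 * real i"
proof -
  note H = assms(8)
  have "odd q" using assms(2,3) prime_odd_nat[of q] by simp
  then have two: "(2::'a) \<noteq> 0" using two_neq_zero_if_odd_card assms(1) by blast
  have i: "2 * i \<le> CARD('r)" using assms(4,6) by auto
  then obtain A B and \<pi> :: "'r \<Rightarrow> 'r"
    where disj: "A \<inter> B = {}" and card: "card (A \<union> B) = 2 * i" and \<pi>: "\<And>k. \<pi> (\<pi> k) = k"
      and AB: "\<And>k. k \<in> A \<Longrightarrow> \<pi> k \<in> B" and BA: "\<And>k. k \<in> B \<Longrightarrow> \<pi> k \<in> A"
    using disjoint_pairing_exists by metis
  have A: "\<forall>k\<in>A. \<pi> k \<notin> A" and B: "\<forall>k\<in>B. \<pi> k \<notin> B" using disj AB BA by blast+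
  define \<tau> :: "'a ^ 'r \<Rightarrow> 'a ^ 'r" where "\<tau> = quad_shear A \<pi> \<circ> inv_into UNIV (quad_shear B \<pi>)"
  have "bij \<tau>"
    unfolding \<tau>_def by (intro bij_comp bij_imp_bij_inv bij_quad_shear A B)
  moreover have "propelinear (S_code H \<tau>)"
    unfolding \<tau>_def by (rule propelinear_S_code_quad_shear[OF H B A])
  moreover have length: "real CARD('n + 'a ^ 'r) = (real q ^ (r + 1) - 1) / (real q - 1)"
  proof -
    have "real CARD('n + 'a ^ 'r) = (real q ^ r - 1) / (real q - 1) + real q ^ r"
      using assms by simp
    also have "\<dots> = (real q ^ (r + 1) - 1) / (real q - 1)"
      using assms(3) by (simp add: field_simps)
    finally show ?thesis .
  qed
  moreover have "real (code_rank (S_code H \<tau>)) = real CARD('n + 'a ^ 'r) - real r - 1 + 2 * real i"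
  proof -
    have span: "vec.span (S_code H \<tau>) =
      {z. y_sum z = 0 \<and> (\<forall>k. k \<notin> A \<union> B \<longrightarrow> x_syndrome H z $ k + y_syndrome z $ k = 0)}"
      unfolding \<tau>_def using H two disj \<pi> AB BA by (rule span_S_code_quad_shear)
    \<comment> \<open>One constraint for each of the \<open>r - 2 * i\<close> unpaired coordinates,
      plus one for the coordinate sum.\<close>
    have "code_rank (S_code H \<tau>) + (r - 2 * i + 1) = CARD('n + 'a ^ 'r)"
      unfolding code_rank_def span
      using dim_syndrome_subspace[OF H, of "A \<union> B"] card assms(4) by simp
    from this[symmetric] show ?thesis using i assms(4) by (simp add: of_nat_diff)
  qed
  ultimately show ?thesis by metis
qed

end
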